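(* Let $0<\alpha\le 1$, let $n$ be a positive integer, and consider the generalized time-fractional differential equation $$D_t^{n\alpha}\psi(x,t)=\mathcal N[\psi(x,t)]+h(x,t)$$ subject to the initial conditions $$\psi(x,0)=f_0(x),\quad D_t^{\alpha}\psi(x,0)=f_1(x),\ \dots,\ D_t^{(n-1)\alpha}\psi(x,0)=f_{n-1}(x),$$ where $h(x,t)$ is a non-homogeneous function and $\mathcal N$ is an operator of the form $$\mathcal N[\psi(x,t)]=\sum_{p=1}^{M}\sum_{q=0}^{Q}c_p(x)\,\psi^{p}(x,t)\,D_x^{q}\psi(x,t).$$ Suppose that the solution $\psi$ is expressed as a fractional power series about $t=0$, $$\psi(x,t)=\sum_{k=0}^{\infty}\frac{\phi_k(x)}{\Gamma(k\alpha+1)}\,t^{k\alpha},\qquad t>0,$$ and that $|\psi(x,t)|<Ce^{\delta t}$ for some $C,\delta>0$, so that its general integral transform $\Psi(x,s)=T_t\{\psi(x,t)\}$ is the series $$\Psi(x,s)=\sum_{k=0}^{\infty}\frac{\nu(s)}{\omega(s)^{k\alpha+1}}\,\phi_k(x),\qquad \omega(s)>\delta,$$ where $\phi_k(x)=f_k(x)$ for $k=0,1,\dots,n-1$ by the initial conditions. Then the subsequent coefficients of this series solution are given by $$\phi_n(x)=\mathcal N[f_0(x)]+h(x,0)$$ and $$\phi_k(x)=D_t^{(k-n)\alpha}\left(\mathcal N\left[\sum_{m=0}^{k-n}\frac{\phi_m(x)\,t^{m\alpha}}{\Gamma(1+m\alpha)}\right]+h(x,t)\right)\Bigg|_{t=0},\qquad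 k=n+1,n+2,\dots$$
   Context: Here $x\in I$, an interval. For $0<\alpha\le1$, $D_t^{\alpha}\psi=I_t^{1-\alpha}\partial_t\psi$ is the Caputo time-fractional derivative, where $I_t^{\beta}\psi(x,t)=\frac{1}{\Gamma(\beta)}\int_0^t(t-\tau)^{\beta-1}\psi(x,\tau)\,d\tau$ for $\beta>0$ and $I_t^{0}\psi=\psi$ (Riemann-Liouville integral). $D_t^{j\alpha}$ denotes the $j$-fold iterate $D_t^{\alpha}D_t^{\alpha}\cdots D_t^{\alpha}$. $D_x^{q}$ is the $q$-th derivative in the spatial variable $x$; $M\ge1$ and $Q\ge0$ are integers and the $c_p(x)$ are coefficient functions of $x$. The general integral transform with respect to $t$ of an integrable function $g(t)$, $t\ge0$, with $|g(t)|\le Ce^{\delta t}$ for some $C,\delta>0$, is $T_t\{g\}(s)=\nu(s)\int_0^{\infty}g(t)e^{-\omega(s)t}\,dt$ for $\omega(s)>\delta$, where $\nu(s)\ne0$ and $\omega(s)$ are positive real functions.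
   Formalization: Added, as the claim fails otherwise: the φ_k are Q times differentiable in x, D_x^q ψ is the termwise differentiated series for q ≤ Q, and h(x,·) is right-continuous at t=0; values at t=0 of fractional derivatives are limits as t→0+. *)

theory Defs
  imports "HOL-Analysis.Analysis"
begin

text \<open>Derivatives are taken relative to the domain of the function: within the interval \<open>I\<close>
  for the spatial variable and within \<open>{0..}\<close> for time, hence one-sided at an endpoint.\<close>

definition deriv_on :: "real set \<Rightarrow> (real \<Rightarrow> real) \<Rightarrow> real \<Rightarrow> real" where
  "deriv_on S f x = vector_derivative f (at x within S)"

definition times_differentiable_on :: "nat \<Rightarrow> (real \<Rightarrow> real) \<Rightarrow> real set \<Rightarrow> bool" where
  "times_differentiable_on m f S \<longleftrightarrow>
     (\<forall>j<m. \<forall>x\<in>S. ((deriv_on S ^^ j) f) differentiable (at x within S))"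

definition RL_integral :: "real \<Rightarrow> (real \<Rightarrow> real) \<Rightarrow> real \<Rightarrow> real" where
  "RL_integral \<beta> g t =
     (if \<beta> = 0 then g t
      else 1 / Gamma \<beta> * integral {0..t} (\<lambda>\<tau>. (t - \<tau>) powr (\<beta> - 1) * g \<tau>))"

text \<open>For \<open>\<alpha> < 1\<close> the integral formula gives the value \<open>0\<close> at \<open>t = 0\<close> for every \<open>g\<close>, so
  the value of a Caputo derivative at \<open>t = 0\<close> has to be understood as its limit for
  \<open>t\<close> tending to \<open>0\<close> from the right.\<close>

definition caputo :: "real \<Rightarrow> (real \<Rightarrow> real) \<Rightarrow> real \<Rightarrow> real" where
  "caputo \<alpha> g = RL_integral (1 - \<alpha>) (deriv_on {0..} g)"

text \<open>The operator involves only spatial derivatives, so it is defined on functions of \<open>x\<close>;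
  for a function \<open>\<psi>\<close> of \<open>x\<close> and \<open>t\<close> it is applied to the time slice \<open>\<lambda>y. \<psi> y t\<close>.\<close>

definition nonlinear_op ::
    "real set \<Rightarrow> (nat \<Rightarrow> real \<Rightarrow> real) \<Rightarrow> nat \<Rightarrow> nat \<Rightarrow> (real \<Rightarrow> real) \<Rightarrow> real \<Rightarrow> real" where
  "nonlinear_op I c M Q u x =
     (\<Sum>p=1..M. \<Sum>q=0..Q. c p x * u x ^ p * (deriv_on I ^^ q) u x)"

definition general_transform ::
    "(real \<Rightarrow> real) \<Rightarrow> (real \<Rightarrow> real) \<Rightarrow> (real \<Rightarrow> real) \<Rightarrow> real \<Rightarrow> real" where
  "general_transform \<nu> \<omega> g s = \<nu> s * integral {0..} (\<lambda>t. g t * exp (- \<omega> s * t))"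

end

theory Submission
  imports Defs
begin

text \<open>In the variable \<open>z = t\<^sup>\<alpha>\<close> a fractional power series that converges for all
  \<open>t > 0\<close> is an entire power series, so such functions form an algebra on which
  everything can be computed from coefficients. Three facts about them carry the proof.
  The value of the series at \<open>0\<^sup>+\<close> is its constant coefficient (\<open>frac_expansion_tendsto\<close>).
  The Caputo derivative acts termwise, shifting the coefficients and multiplying them by Gamma
  quotients that are tailored to the normalisation \<open>\<phi>\<^sub>k / \<Gamma>(k\<alpha> + 1)\<close>
  (\<open>caputo_frac_series\<close>); hence the limit of \<open>D\<^sup>j\<^sup>\<alpha> g\<close> at \<open>0\<^sup>+\<close> is \<open>\<Gamma>(j\<alpha> + 1)\<close> times
  the \<open>j\<close>-th coefficient of \<open>g\<close> (\<open>caputo_iter_tendsto\<close>). Finally, since the nonlinear operator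
  is polynomial in \<open>\<psi>\<close> and its spatial derivatives, it maps such series to such series, and the
  coefficients of the result up to index \<open>K\<close> depend only on those of the arguments up to \<open>K\<close>
  (\<open>frac_expansion_nonlinear_op\<close>, \<open>nonlinear_fps_cutoff_cong\<close>).

  The initial conditions thus identify \<open>\<phi>\<^sub>k\<close> with \<open>f\<^sub>k\<close> for \<open>k < n\<close>, and letting \<open>t\<close> tend to
  \<open>0\<close> in the equation gives \<open>\<phi>\<^sub>n\<close>. For the later coefficients, the equation exhibits \<open>h\<close> itself as
  a fractional power series, namely that of \<open>D\<^sup>n\<^sup>\<alpha> \<psi> - N[\<psi>]\<close>. With \<open>\<psi>\<^sub>K\<close> the partial sum of
  \<open>\<psi>\<close> up to index \<open>K = k - n\<close>, the function \<open>N[\<psi>\<^sub>K] + h\<close> equals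
  \<open>D\<^sup>n\<^sup>\<alpha> \<psi> - (N[\<psi>] - N[\<psi>\<^sub>K])\<close>, and the bracket has no coefficients up to index \<open>K\<close>. So
  \<open>D\<^sup>K\<^sup>\<alpha> (N[\<psi>\<^sub>K] + h)\<close> has the same limit at \<open>0\<^sup>+\<close> as \<open>D\<^sup>(\<^sup>K\<^sup>+\<^sup>n\<^sup>)\<^sup>\<alpha> \<psi>\<close>, which is \<open>\<phi>\<^sub>k\<close>.\<close>

section \<open>Functions given by a power series in a fractional power of time\<close>

text \<open>Only times \<open>t > 0\<close> are constrained: the Caputo derivative at \<open>t > 0\<close> and the limits at
  \<open>0\<^sup>+\<close> do not see the value at \<open>0\<close>.\<close>

definition frac_expansion :: "real \<Rightarrow> (real \<Rightarrow> real) \<Rightarrow> real fps \<Rightarrow> bool" where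
  "frac_expansion \<alpha> g A \<longleftrightarrow> (\<forall>t>0. (\<lambda>k. fps_nth A k * (t powr \<alpha>) ^ k) sums g t)"

text \<open>Every \<open>r > 0\<close> is of the form \<open>t\<^sup>\<alpha>\<close>, so convergence for all times is convergence on the whole
  line. This gives access to the algebra of power series inside their disc of convergence.\<close>

lemma frac_expansion_conv_radius:
  assumes "\<alpha> > 0" "frac_expansion \<alpha> g A"
  shows "fps_conv_radius A = \<infinity>"
  unfolding fps_conv_radius_def
proof (rule conv_radius_inftyI'[where c = 0])
  fix r :: real assume "r > 0"
  then have "(r powr (1 / \<alpha>)) powr \<alpha> = r" "r powr (1 / \<alpha>) > 0"
    using assms(1) by (simp_all add: powr_powr)
  then have "summable (\<lambda>k. fps_nth A k * r ^ k)"
    using assms(2) unfolding frac_expansion_def by (metis sums_summable)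
  with \<open>r > 0\<close> show "\<exists>z. norm z = r \<and> summable (\<lambda>k. fps_nth A k * z ^ k)"
    by (intro exI[of _ r]) simp
qed

lemma frac_expansion_iff_eval_fps:
  assumes "\<alpha> > 0"
  shows "frac_expansion \<alpha> g A \<longleftrightarrow>
    fps_conv_radius A = \<infinity> \<and> (\<forall>t>0. g t = eval_fps A (t powr \<alpha>))"
proof safe
  assume A: "frac_expansion \<alpha> g A"
  show "fps_conv_radius A = \<infinity>"
    by (rule frac_expansion_conv_radius[OF assms A])
  fix t :: real assume "t > 0"
  with A show "g t = eval_fps A (t powr \<alpha>)"
    by (auto simp: frac_expansion_def eval_fps_def sums_iff)
next
  assume R: "fps_conv_radius A = \<infinity>" and E: "\<forall>t>0. g t = eval_fps A (t powr \<alpha>)"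
  show "frac_expansion \<alpha> g A"
    unfolding frac_expansion_def
  proof safe
    fix t :: real assume "t > 0"
    moreover have "summable (\<lambda>k. fps_nth A k * (t powr \<alpha>) ^ k)"
      by (rule summable_fps) (simp add: R)
    ultimately show "(\<lambda>k. fps_nth A k * (t powr \<alpha>) ^ k) sums g t"
      using E by (simp add: eval_fps_def sums_iff)
  qed
qed

lemma frac_expansion_cong:
  assumes "frac_expansion \<alpha> g A" "\<And>t. t > 0 \<Longrightarrow> g t = g' t"
  shows "frac_expansion \<alpha> g' A"
  using assms by (simp add: frac_expansion_def)

lemma frac_expansion_0: "frac_expansion \<alpha> (\<lambda>t. 0) 0"
  by (simp add: frac_expansion_def)

lemma frac_expansion_const: "\<alpha> > 0 \<Longrightarrow> frac_expansion \<alpha> (\<lambda>t. c) (fps_const c)"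
  by (simp add: frac_expansion_iff_eval_fps)

lemma frac_expansion_add:
  "frac_expansion \<alpha> g A \<Longrightarrow> frac_expansion \<alpha> g' B \<Longrightarrow> frac_expansion \<alpha> (\<lambda>t. g t + g' t) (A + B)"
  by (auto simp: frac_expansion_def ring_distribs intro!: sums_add)

lemma frac_expansion_diff:
  "frac_expansion \<alpha> g A \<Longrightarrow> frac_expansion \<alpha> g' B \<Longrightarrow> frac_expansion \<alpha> (\<lambda>t. g t - g' t) (A - B)"
  by (auto simp: frac_expansion_def ring_distribs intro!: sums_diff)

lemma frac_expansion_sum:
  assumes "\<And>i. i \<in> S \<Longrightarrow> frac_expansion \<alpha> (g i) (A i)"
  shows "frac_expansion \<alpha> (\<lambda>t. \<Sum>i\<in>S. g i t) (\<Sum>i\<in>S. A i)"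
  using assms
  by (induction S rule: infinite_finite_induct) (auto intro: frac_expansion_0 frac_expansion_add)

lemma frac_expansion_mult:
  assumes "\<alpha> > 0" "frac_expansion \<alpha> g A" "frac_expansion \<alpha> g' B"
  shows "frac_expansion \<alpha> (\<lambda>t. g t * g' t) (A * B)"
proof -
  have R: "fps_conv_radius A = \<infinity>" "fps_conv_radius B = \<infinity>"
    using assms by (blast intro: frac_expansion_conv_radius)+
  then have "fps_conv_radius (A * B) = \<infinity>"
    using fps_conv_radius_mult[of A B] by simp
  with R assms show ?thesis
    by (auto simp: frac_expansion_iff_eval_fps eval_fps_mult)
qed

lemma frac_expansion_power:
  assumes "\<alpha> > 0" "frac_expansion \<alpha> g A"
  shows "frac_expansion \<alpha> (\<lambda>t. g t ^ p) (A ^ p)"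
proof (induction p)
  case 0
  show ?case using frac_expansion_const[OF assms(1), of 1] by simp
next
  case (Suc p)
  then show ?case using frac_expansion_mult[OF assms(1,2) Suc] by simp
qed

lemma frac_expansion_tendsto:
  assumes "\<alpha> > 0" "frac_expansion \<alpha> g A"
  shows "(g \<longlongrightarrow> fps_nth A 0) (at_right 0)"
proof -
  have R: "fps_conv_radius A = \<infinity>"
    by (rule frac_expansion_conv_radius[OF assms])
  have "((\<lambda>t. t powr \<alpha>) \<longlongrightarrow> 0) (at_right (0::real))"
    using assms(1) by (intro tendsto_eq_intros | simp add: eventually_at_filter)+
  moreover have "isCont (eval_fps A) 0"
    by (rule continuous_eval_fps) (simp add: R)
  ultimately have "((\<lambda>t. eval_fps A (t powr \<alpha>)) \<longlongrightarrow> eval_fps A 0) (at_right 0)"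
    using isCont_tendsto_compose by blast
  moreover have "eventually (\<lambda>t. eval_fps A (t powr \<alpha>) = g t) (at_right 0)"
    using assms by (auto simp: frac_expansion_iff_eval_fps eventually_at_filter)
  ultimately show ?thesis
    by (simp add: eval_fps_at_0 tendsto_cong)
qed

section \<open>Termwise Caputo differentiation\<close>

lemma frac_expansion_deriv_on:
  assumes "\<alpha> > 0" "frac_expansion \<alpha> g A" "t > 0"
  shows "(\<lambda>k. \<alpha> * real (Suc k) * fps_nth A (Suc k) * t powr (real (Suc k) * \<alpha> - 1))
           sums deriv_on {0..} g t"
proof -
  have R: "fps_conv_radius A = \<infinity>" and E: "\<And>t. t > 0 \<Longrightarrow> g t = eval_fps A (t powr \<alpha>)"
    using assms by (auto simp: frac_expansion_iff_eval_fps)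
  have R': "fps_conv_radius (fps_deriv A) = \<infinity>"
    using fps_conv_radius_deriv[of A] by (simp add: R)
  let ?D = "eval_fps (fps_deriv A) (t powr \<alpha>) * (\<alpha> * t powr (\<alpha> - 1))"
  have "((\<lambda>t. t powr \<alpha>) has_field_derivative \<alpha> * t powr (\<alpha> - 1)) (at t)"
    using assms(3) by (auto intro!: derivative_eq_intros)
  then have "((\<lambda>t. eval_fps A (t powr \<alpha>)) has_field_derivative ?D) (at t)"
    by (intro DERIV_chain2[OF has_field_derivative_eval_fps]) (auto simp: R)
  then have "(g has_field_derivative ?D) (at t)"
    by (rule has_field_derivative_transform_within_open[where S = "{0<..}"])
       (use assms(3) E in auto)
  then have "(g has_vector_derivative ?D) (at t within {0..})"
    by (simp add: has_real_derivative_iff_has_vector_derivative has_vector_derivative_at_within)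
  moreover have "t \<in> interior {0..}"
    using assms(3) by (simp add: interior_real_atLeast)
  then have "at t within {0..} \<noteq> bot"
    by (metis at_within_interior at_neq_bot)
  ultimately have D: "deriv_on {0..} g t = ?D"
    unfolding deriv_on_def by (intro vector_derivative_within)
  have "(\<lambda>k. fps_nth (fps_deriv A) k * (t powr \<alpha>) ^ k) sums eval_fps (fps_deriv A) (t powr \<alpha>)"
    unfolding eval_fps_def by (intro summable_sums summable_fps) (simp add: R')
  from sums_mult2[OF this, of "\<alpha> * t powr (\<alpha> - 1)"]
  have "(\<lambda>k. fps_nth (fps_deriv A) k * (t powr \<alpha>) ^ k * (\<alpha> * t powr (\<alpha> - 1)))
      sums deriv_on {0..} g t"
    unfolding D .
  moreover have "t powr (real (Suc k) * \<alpha> - 1) = (t powr \<alpha>) ^ k * t powr (\<alpha> - 1)" for k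
  proof -
    have "real (Suc k) * \<alpha> - 1 = real k * \<alpha> + (\<alpha> - 1)" by (simp add: algebra_simps)
    then show ?thesis
      using assms(3) by (simp only: powr_add) (simp add: powr_power mult.commute)
  qed
  ultimately show ?thesis
    by (simp add: mult.assoc mult.left_commute)
qed

text \<open>The Beta integral, rescaled from \<open>[0, 1]\<close> to \<open>[0, t]\<close>.\<close>

lemma has_integral_RL_kernel:
  fixes a b t :: real
  assumes "a > 0" "b > 0" "t > 0"
  shows "((\<lambda>\<tau>. (t - \<tau>) powr (b - 1) * \<tau> powr (a - 1)) has_integral
           Beta a b * t powr (a + b - 1)) {0..t}"
proof -
  have "((\<lambda>\<tau>. (\<tau> / t) powr (a - 1) * (1 - \<tau> / t) powr (b - 1)) has_integral t * Beta a b) {0..t}"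
    using has_integral_affinity'[of "\<lambda>t. t powr (a - 1) * (1 - t) powr (b - 1)" "Beta a b" 0 1 "1/t" 0]
      has_integral_Beta_real[OF assms(1,2)] assms(3) by (simp add: field_simps)
  from has_integral_mult_right[OF this, of "t powr (a + b - 2)"]
  have "((\<lambda>\<tau>. t powr (a + b - 2) * ((\<tau> / t) powr (a - 1) * (1 - \<tau> / t) powr (b - 1))) has_integral
      Beta a b * t powr (a + b - 1)) {0..t}"
    using assms(3) by (simp add: mult_ac powr_diff power2_eq_square)
  then show ?thesis
  proof (rule has_integral_eq[rotated])
    fix \<tau> assume "\<tau> \<in> {0..t}"
    moreover from this have "1 - \<tau> / t = (t - \<tau>) / t"
      using assms(3) by (simp add: field_simps)
    moreover have "t powr (a + b - 2) = t powr (a - 1) * t powr (b - 1)"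
      by (simp add: algebra_simps flip: powr_add)
    ultimately show "t powr (a + b - 2) * ((\<tau> / t) powr (a - 1) * (1 - \<tau> / t) powr (b - 1)) =
        (t - \<tau>) powr (b - 1) * \<tau> powr (a - 1)"
      using assms(3) by (simp add: powr_divide field_simps)
  qed
qed


definition caputo_fps :: "real \<Rightarrow> real fps \<Rightarrow> real fps" where
  "caputo_fps \<alpha> A = Abs_fps (\<lambda>k. fps_nth A (Suc k) *
     (Gamma (real (Suc k) * \<alpha> + 1) / Gamma (real k * \<alpha> + 1)))"

text \<open>For \<open>\<alpha> = 1\<close> this is termwise differentiation. For \<open>\<alpha> < 1\<close> the differentiated series is integrated
  termwise against the kernel \<open>(t - \<tau>)\<^sup>-\<^sup>\<alpha>\<close>; each term is a Beta integral. Dominated convergence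
  applies because all terms share the integrable factor \<open>(t - \<tau>)\<^sup>-\<^sup>\<alpha> \<tau>\<^sup>\<alpha>\<^sup>-\<^sup>1\<close>, and the remaining
  factors \<open>\<tau>\<^sup>k\<^sup>\<alpha>\<close> are at most \<open>t\<^sup>k\<^sup>\<alpha>\<close>. The convergence of the resulting series comes with it, without
  any growth estimate for the Gamma quotients.\<close>

lemma caputo_frac_series:
  assumes "0 < \<alpha>" "\<alpha> \<le> 1" "frac_expansion \<alpha> g A" "t > 0"
  shows "(\<lambda>k. fps_nth (caputo_fps \<alpha> A) k * (t powr \<alpha>) ^ k) sums caputo \<alpha> g t"
proof -
  define a where "a k = \<alpha> * real (Suc k) * fps_nth A (Suc k)" for k
  have deriv: "(\<lambda>k. a k * \<tau> powr (real (Suc k) * \<alpha> - 1)) sums deriv_on {0..} g \<tau>"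
    if "\<tau> > 0" for \<tau>
    unfolding a_def by (rule frac_expansion_deriv_on[OF assms(1,3) that])
  have Gamma_Suc: "Gamma (real (Suc k) * \<alpha> + 1) = real (Suc k) * \<alpha> * Gamma (real (Suc k) * \<alpha>)" for k
  proof -
    have "real (Suc k) * \<alpha> > 0" using assms(1) by simp
    then have "real (Suc k) * \<alpha> \<notin> \<int>\<^sub>\<le>\<^sub>0" by (metis nonpos_Ints_nonpos not_le)
    then show ?thesis by (rule Gamma_plus1)
  qed
  have coeff: "fps_nth (caputo_fps \<alpha> A) k =
      a k * Gamma (real (Suc k) * \<alpha>) / Gamma (real k * \<alpha> + 1)" for k
    unfolding caputo_fps_def a_def fps_nth_Abs_fps Gamma_Suc by simp
  show ?thesis
  proof (cases "\<alpha> = 1")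
    case True
    have "caputo \<alpha> g t = deriv_on {0..} g t"
      by (simp add: caputo_def RL_integral_def True)
    moreover have "fps_nth (caputo_fps \<alpha> A) k * (t powr \<alpha>) ^ k =
        a k * t powr (real (Suc k) * \<alpha> - 1)" for k
    proof -
      have "Gamma (1 + real k) \<noteq> 0"
        by (rule Gamma_real_pos[THEN less_imp_neq, symmetric]) simp
      then have "fps_nth (caputo_fps \<alpha> A) k = a k"
        unfolding coeff by (simp add: True add_ac)
      then show ?thesis
        using assms(4) by (simp add: True powr_realpow)
    qed
    ultimately show ?thesis using deriv[OF assms(4)] by simp
  next
    case False
    with assms have \<alpha>: "0 < \<alpha>" "\<alpha> < 1" by auto
    define F where "F k \<tau> = (t - \<tau>) powr (1 - \<alpha> - 1) * \<tau> powr (real (Suc k) * \<alpha> - 1)" for k \<tau>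
    define B where "B k = Beta (real (Suc k) * \<alpha>) (1 - \<alpha>) * (t powr \<alpha>) ^ k" for k
    have F: "(F k has_integral B k) {0..t}" for k
    proof -
      have "t powr (real (Suc k) * \<alpha> + (1 - \<alpha>) - 1) = (t powr \<alpha>) ^ k"
        using assms(4) by (simp add: powr_power algebra_simps)
      then show ?thesis
        using has_integral_RL_kernel[of "real (Suc k) * \<alpha>" "1 - \<alpha>" t] \<alpha> assms(4)
        unfolding F_def B_def by simp
    qed
    \<comment> \<open>At \<open>\<tau> = 0\<close> all terms vanish, since \<open>0 powr c = 0\<close>, while the derivative of \<open>g\<close> there is arbitrary.\<close>
    define d where "d \<tau> = (if \<tau> = 0 then 0 else deriv_on {0..} g \<tau>)" for \<tau>
    define W where "W = (\<Sum>k. \<bar>a k\<bar> * (t powr \<alpha>) ^ k)"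
    have W: "summable (\<lambda>k. \<bar>a k\<bar> * (t powr \<alpha>) ^ k)"
    proof -
      have "fps_conv_radius (fps_deriv A) = \<infinity>"
        using fps_conv_radius_deriv[of A] frac_expansion_conv_radius[OF assms(1,3)] by simp
      then have "summable (\<lambda>k. norm (fps_nth (fps_deriv A) k * (t powr \<alpha>) ^ k))"
        by (intro norm_summable_fps) simp
      from summable_mult[OF this, of \<alpha>] show ?thesis
        using assms(1) by (simp add: a_def abs_mult mult_ac)
    qed
    have partial_sums: "(\<lambda>N. integral {0..t} (\<lambda>\<tau>. \<Sum>k<N. a k * F k \<tau>)) \<longlonglongrightarrow>
        integral {0..t} (\<lambda>\<tau>. (t - \<tau>) powr (1 - \<alpha> - 1) * d \<tau>)"
    proof (rule dominated_convergence(2))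
      show "(\<lambda>\<tau>. \<Sum>k<N. a k * F k \<tau>) integrable_on {0..t}" for N
        using F by (intro integrable_sum integrable_on_mult_right finite_lessThan)
          (auto simp: integrable_on_def)
      show "(\<lambda>\<tau>. W * F 0 \<tau>) integrable_on {0..t}"
        using F[of 0] by (intro integrable_on_mult_right) (auto simp: integrable_on_def)
    next
      fix N \<tau> assume \<tau>: "\<tau> \<in> {0..t}"
      have "norm (a k * F k \<tau>) \<le> F 0 \<tau> * (\<bar>a k\<bar> * (t powr \<alpha>) ^ k)" for k
      proof (cases "\<tau> = 0")
        case True
        then show ?thesis by (simp add: F_def)
      next
        case False
        then have "F k \<tau> = F 0 \<tau> * (\<tau> powr \<alpha>) ^ k"
          using \<tau> by (simp add: F_def powr_power ring_distribs diff_add_eq mult_ac flip: powr_add)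
        also have "\<dots> \<le> F 0 \<tau> * (t powr \<alpha>) ^ k"
          using \<tau> \<alpha> by (intro mult_left_mono power_mono powr_mono2) (auto simp: F_def)
        finally have "\<bar>a k\<bar> * F k \<tau> \<le> \<bar>a k\<bar> * (F 0 \<tau> * (t powr \<alpha>) ^ k)"
          by (intro mult_left_mono) auto
        moreover have "F k \<tau> \<ge> 0" by (simp add: F_def)
        ultimately show ?thesis by (simp add: abs_mult mult_ac)
      qed
      then have "norm (\<Sum>k<N. a k * F k \<tau>) \<le> (\<Sum>k<N. F 0 \<tau> * (\<bar>a k\<bar> * (t powr \<alpha>) ^ k))"
        by (intro sum_norm_le)
      also have "\<dots> = F 0 \<tau> * (\<Sum>k<N. \<bar>a k\<bar> * (t powr \<alpha>) ^ k)"
        by (simp add: sum_distrib_left)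
      also have "\<dots> \<le> F 0 \<tau> * W"
        unfolding W_def by (intro mult_left_mono sum_le_suminf W) (auto simp: F_def)
      finally show "norm (\<Sum>k<N. a k * F k \<tau>) \<le> W * F 0 \<tau>" by (simp add: mult_ac)
    next
      fix \<tau> assume \<tau>: "\<tau> \<in> {0..t}"
      have "(\<lambda>k. a k * F k \<tau>) sums ((t - \<tau>) powr (1 - \<alpha> - 1) * d \<tau>)"
      proof (cases "\<tau> = 0")
        case True
        then show ?thesis by (simp add: F_def d_def)
      next
        case False
        then show ?thesis
          using sums_mult[OF deriv[of \<tau>], of "(t - \<tau>) powr (1 - \<alpha> - 1)"] \<tau>
          by (simp add: F_def d_def mult_ac)
      qed
      then show "(\<lambda>N. \<Sum>k<N. a k * F k \<tau>) \<longlonglongrightarrow> (t - \<tau>) powr (1 - \<alpha> - 1) * d \<tau>"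
        by (simp add: sums_def)
    qed
    have "integral {0..t} (\<lambda>\<tau>. \<Sum>k<N. a k * F k \<tau>) = (\<Sum>k<N. a k * B k)" for N
      by (intro integral_unique has_integral_sum has_integral_mult_right F) auto
    with partial_sums have
      "(\<lambda>k. a k * B k) sums integral {0..t} (\<lambda>\<tau>. (t - \<tau>) powr (1 - \<alpha> - 1) * d \<tau>)"
      by (simp add: sums_def)
    also have "integral {0..t} (\<lambda>\<tau>. (t - \<tau>) powr (1 - \<alpha> - 1) * d \<tau>) =
        integral {0..t} (\<lambda>\<tau>. (t - \<tau>) powr (1 - \<alpha> - 1) * deriv_on {0..} g \<tau>)"
      by (rule integral_spike[where S = "{0}"]) (auto simp: d_def)
    finally have "(\<lambda>k. 1 / Gamma (1 - \<alpha>) * (a k * B k)) sums caputo \<alpha> g t"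
      unfolding caputo_def RL_integral_def using \<alpha> by (simp add: sums_divide)
    moreover have "1 / Gamma (1 - \<alpha>) * (a k * B k) =
        fps_nth (caputo_fps \<alpha> A) k * (t powr \<alpha>) ^ k" for k
    proof -
      have "Gamma (1 - \<alpha>) > 0" using \<alpha> by (intro Gamma_real_pos) simp
      moreover have "real (Suc k) * \<alpha> + (1 - \<alpha>) = real k * \<alpha> + 1"
        by (simp add: algebra_simps)
      moreover from this have "Beta (real (Suc k) * \<alpha>) (1 - \<alpha>) =
          Gamma (real (Suc k) * \<alpha>) * Gamma (1 - \<alpha>) / Gamma (real k * \<alpha> + 1)"
        unfolding Beta_def by (simp only:)
      ultimately show ?thesis
        by (simp add: coeff B_def)
    qed
    ultimately show ?thesis by simp
  qed
qed

lemma frac_expansion_caputo: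
  assumes "0 < \<alpha>" "\<alpha> \<le> 1" "frac_expansion \<alpha> g A"
  shows "frac_expansion \<alpha> (caputo \<alpha> g) (caputo_fps \<alpha> A)"
  using caputo_frac_series[OF assms] by (simp add: frac_expansion_def)

lemma frac_expansion_caputo_iter:
  assumes "0 < \<alpha>" "\<alpha> \<le> 1" "frac_expansion \<alpha> g A"
  shows "frac_expansion \<alpha> ((caputo \<alpha> ^^ j) g) ((caputo_fps \<alpha> ^^ j) A)"
  by (induction j) (auto intro: frac_expansion_caputo assms)

lemma caputo_fps_iter_nth:
  assumes "\<alpha> > 0"
  shows "fps_nth ((caputo_fps \<alpha> ^^ j) A) k =
    fps_nth A (k + j) * (Gamma (real (k + j) * \<alpha> + 1) / Gamma (real k * \<alpha> + 1))"
proof (induction j arbitrary: k)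
  case 0
  have "Gamma (real k * \<alpha> + 1) > 0"
    using assms by (intro Gamma_real_pos add_nonneg_pos) auto
  then show ?case by simp
next
  case (Suc j)
  have "Gamma (real (Suc k) * \<alpha> + 1) > 0"
    using assms by (intro Gamma_real_pos add_nonneg_pos) auto
  moreover have "fps_nth ((caputo_fps \<alpha> ^^ Suc j) A) k =
      fps_nth ((caputo_fps \<alpha> ^^ j) A) (Suc k) *
        (Gamma (real (Suc k) * \<alpha> + 1) / Gamma (real k * \<alpha> + 1))"
    by (simp add: caputo_fps_def)
  ultimately show ?case
    unfolding Suc by simp
qed

lemma caputo_iter_tendsto:
  assumes "0 < \<alpha>" "\<alpha> \<le> 1" "frac_expansion \<alpha> g A"
  shows "((caputo \<alpha> ^^ j) g \<longlongrightarrow> fps_nth A j * Gamma (real j * \<alpha> + 1)) (at_right 0)"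
  using frac_expansion_tendsto[OF assms(1) frac_expansion_caputo_iter[OF assms, of j]] assms(1)
  by (simp add: caputo_fps_iter_nth)

section \<open>The nonlinear operator on series\<close>

lemma deriv_on_cong:
  assumes "\<And>y. y \<in> S \<Longrightarrow> u y = v y" "x \<in> S"
  shows "deriv_on S u x = deriv_on S v x"
  unfolding deriv_on_def using assms by (intro vector_derivative_cong_eq) auto

lemma deriv_on_iter_cong:
  assumes "\<And>y. y \<in> S \<Longrightarrow> u y = v y" "x \<in> S"
  shows "(deriv_on S ^^ q) u x = (deriv_on S ^^ q) v x"
  using assms(2)
proof (induction q arbitrary: x)
  case 0
  then show ?case by (simp add: assms(1))
next
  case (Suc q)
  then show ?case by (auto intro: deriv_on_cong)
qed

lemma nonlinear_op_cong:
  assumes "\<And>y. y \<in> S \<Longrightarrow> u y = v y" "x \<in> S"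
  shows "nonlinear_op S c M Q u x = nonlinear_op S c M Q v x"
proof -
  have "(deriv_on S ^^ q) u x = (deriv_on S ^^ q) v x" for q
    by (rule deriv_on_iter_cong[OF assms])
  then show ?thesis by (simp add: nonlinear_op_def assms)
qed

text \<open>The non-degenerate interval makes every point of \<open>S\<close> a limit point of \<open>S\<close>, so one-sided derivatives
  are unique and hence linear.\<close>

lemma deriv_on_iter_sum:
  fixes b :: "'i \<Rightarrow> real"
  assumes S: "is_interval S" "interior S \<noteq> {}" and "finite J"
    and diff: "\<And>m. m \<in> J \<Longrightarrow> times_differentiable_on Q (u m) S"
    and "q \<le> Q" "x \<in> S"
  shows "(deriv_on S ^^ q) (\<lambda>y. \<Sum>m\<in>J. b m * u m y) x =
    (\<Sum>m\<in>J. b m * (deriv_on S ^^ q) (u m) x)"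
  using \<open>q \<le> Q\<close> \<open>x \<in> S\<close>
proof (induction q arbitrary: x)
  case 0
  show ?case by simp
next
  case (Suc q)
  let ?D = "\<lambda>m. (deriv_on S ^^ q) (u m)"
  have "\<not> (\<exists>a. S = {a})"
    using S(2) by (auto simp: interior_singleton)
  then have nontrivial: "at x within S \<noteq> bot"
    using connected_imp_perfect[of S x] S(1) Suc.prems
    by (auto simp: trivial_limit_within is_interval_connected_1)
  have "(?D m has_vector_derivative deriv_on S (?D m) x) (at x within S)" if "m \<in> J" for m
  proof -
    have "?D m differentiable (at x within S)"
      using diff[OF that] Suc.prems by (simp add: times_differentiable_on_def)
    then show ?thesis
      by (simp add: deriv_on_def vector_derivative_works)
  qed
  then have "((\<lambda>y. \<Sum>m\<in>J. b m * ?D m y) has_vector_derivative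
      (\<Sum>m\<in>J. b m * deriv_on S (?D m) x)) (at x within S)"
    by (intro has_vector_derivative_sum has_vector_derivative_mult_right)
  then have "deriv_on S (\<lambda>y. \<Sum>m\<in>J. b m * ?D m y) x = (\<Sum>m\<in>J. b m * deriv_on S (?D m) x)"
    unfolding deriv_on_def by (rule vector_derivative_within[OF nontrivial])
  moreover have "deriv_on S ((deriv_on S ^^ q) (\<lambda>y. \<Sum>m\<in>J. b m * u m y)) x =
      deriv_on S (\<lambda>y. \<Sum>m\<in>J. b m * ?D m y) x"
    using Suc by (intro deriv_on_cong) auto
  ultimately show ?case by simp
qed

text \<open>The operator at a fixed point \<open>x\<close>, on coefficient series: \<open>V q\<close> stands for the series of
  the \<open>q\<close>-th spatial derivative at \<open>x\<close>, so \<open>V 0\<close> for that of the function itself.\<close>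

definition nonlinear_fps :: "(nat \<Rightarrow> real) \<Rightarrow> nat \<Rightarrow> nat \<Rightarrow> (nat \<Rightarrow> real fps) \<Rightarrow> real fps" where
  "nonlinear_fps b M Q V = (\<Sum>p=1..M. \<Sum>q=0..Q. fps_const (b p) * V 0 ^ p * V q)"

lemma frac_expansion_nonlinear_op:
  assumes "\<alpha> > 0"
    and V: "\<And>q. q \<le> Q \<Longrightarrow> frac_expansion \<alpha> (\<lambda>t. (deriv_on S ^^ q) (\<lambda>y. u y t) x) (V q)"
  shows "frac_expansion \<alpha> (\<lambda>t. nonlinear_op S c M Q (\<lambda>y. u y t) x)
    (nonlinear_fps (\<lambda>p. c p x) M Q V)"
proof -
  have "frac_expansion \<alpha> (\<lambda>t. u x t) (V 0)"
    using V[of 0] by simp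
  then show ?thesis
    unfolding nonlinear_op_def nonlinear_fps_def
    by (intro frac_expansion_sum frac_expansion_mult frac_expansion_const frac_expansion_power
        assms) auto
qed

text \<open>Equality of cutoffs is congruence modulo \<open>X\<^sup>n\<close>, a ring congruence.\<close>

lemma fps_cutoff_mult_cong:
  fixes A B :: "'a::semiring_1 fps"
  assumes "fps_cutoff n A = fps_cutoff n A'" "fps_cutoff n B = fps_cutoff n B'"
  shows "fps_cutoff n (A * B) = fps_cutoff n (A' * B')"
  unfolding fps_cutoff_eq_fps_cutoff_iff fps_mult_nth
proof (intro allI impI sum.cong refl)
  fix k i assume "k < n" "i \<in> {0..k}"
  then have "i < n" "k - i < n" by auto
  with assms show "fps_nth A i * fps_nth B (k - i) = fps_nth A' i * fps_nth B' (k - i)"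
    unfolding fps_cutoff_eq_fps_cutoff_iff by metis
qed

lemma fps_cutoff_power_cong:
  fixes A :: "'a::semiring_1 fps"
  assumes "fps_cutoff n A = fps_cutoff n A'"
  shows "fps_cutoff n (A ^ p) = fps_cutoff n (A' ^ p)"
proof (induction p)
  case (Suc p)
  show ?case unfolding power_Suc by (rule fps_cutoff_mult_cong[OF assms Suc])
qed simp

lemma fps_cutoff_sum:
  fixes A :: "'i \<Rightarrow> 'a::comm_monoid_add fps"
  shows "fps_cutoff n (\<Sum>i\<in>J. A i) = (\<Sum>i\<in>J. fps_cutoff n (A i))"
  by (induction J rule: infinite_finite_induct) (simp_all add: fps_cutoff_add)

lemma nonlinear_fps_cutoff_cong:
  assumes "\<And>q. q \<le> Q \<Longrightarrow> fps_cutoff n (V q) = fps_cutoff n (V' q)"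
  shows "fps_cutoff n (nonlinear_fps b M Q V) = fps_cutoff n (nonlinear_fps b M Q V')"
  unfolding nonlinear_fps_def fps_cutoff_sum
  using assms by (intro sum.cong fps_cutoff_mult_cong fps_cutoff_power_cong) auto

lemma frac_expansion_partial_sum:
  "frac_expansion \<alpha> (\<lambda>t. \<Sum>k=0..K. fps_nth A k * (t powr \<alpha>) ^ k) (fps_cutoff (Suc K) A)"
  unfolding frac_expansion_def
proof safe
  fix t :: real
  have "(\<lambda>k. fps_nth (fps_cutoff (Suc K) A) k * (t powr \<alpha>) ^ k) sums
      (\<Sum>k=0..K. fps_nth (fps_cutoff (Suc K) A) k * (t powr \<alpha>) ^ k)"
    by (rule sums_finite) auto
  also have "(\<Sum>k=0..K. fps_nth (fps_cutoff (Suc K) A) k * (t powr \<alpha>) ^ k) =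
      (\<Sum>k=0..K. fps_nth A k * (t powr \<alpha>) ^ k)"
    by (intro sum.cong) auto
  finally show "(\<lambda>k. fps_nth (fps_cutoff (Suc K) A) k * (t powr \<alpha>) ^ k) sums
      (\<Sum>k=0..K. fps_nth A k * (t powr \<alpha>) ^ k)" .
qed

section \<open>The coefficients of the solution\<close>

theorem mainTheorem2:
  fixes \<alpha> :: real and n M Q :: nat and I S :: "real set"
    and \<psi> h :: "real \<Rightarrow> real \<Rightarrow> real"
    and f \<phi> c :: "nat \<Rightarrow> real \<Rightarrow> real"
    and \<nu> \<omega> :: "real \<Rightarrow> real" and C \<delta> :: real
  assumes alpha: "0 < \<alpha>" "\<alpha> \<le> 1"
    and n: "n \<ge> 1" and M: "M \<ge> 1"
    and I: "is_interval I" "interior I \<noteq> {}"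
    and equation: "\<And>x t. x \<in> I \<Longrightarrow> t > 0 \<Longrightarrow>
          (caputo \<alpha> ^^ n) (\<psi> x) t = nonlinear_op I c M Q (\<lambda>y. \<psi> y t) x + h x t"
    and initial: "\<And>x j. x \<in> I \<Longrightarrow> j < n \<Longrightarrow>
          (((caputo \<alpha> ^^ j) (\<psi> x)) \<longlongrightarrow> f j x) (at_right 0)"
    and h_cont: "\<And>x. x \<in> I \<Longrightarrow> continuous (at_right 0) (h x)"
    and series: "\<And>x t. x \<in> I \<Longrightarrow> t > 0 \<Longrightarrow>
          (\<lambda>k. \<phi> k x / Gamma (real k * \<alpha> + 1) * t powr (real k * \<alpha>)) sums \<psi> x t"
    and psi_diff: "\<And>t. t > 0 \<Longrightarrow> times_differentiable_on Q (\<lambda>y. \<psi> y t) I"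
    and phi_diff: "\<And>k. times_differentiable_on Q (\<phi> k) I"
    and termwise: "\<And>x t q. x \<in> I \<Longrightarrow> t > 0 \<Longrightarrow> q \<le> Q \<Longrightarrow>
          (\<lambda>k. (deriv_on I ^^ q) (\<phi> k) x / Gamma (real k * \<alpha> + 1) * t powr (real k * \<alpha>))
            sums (deriv_on I ^^ q) (\<lambda>y. \<psi> y t) x"
    and growth: "C > 0" "\<delta> > 0"
          "\<And>x t. x \<in> I \<Longrightarrow> t > 0 \<Longrightarrow> \<bar>\<psi> x t\<bar> < C * exp (\<delta> * t)"
    and kernel: "\<And>s. s \<in> S \<Longrightarrow> \<nu> s \<noteq> 0 \<and> \<omega> s > 0"
    and transform: "\<And>x s. x \<in> I \<Longrightarrow> s \<in> S \<Longrightarrow> \<omega> s > \<delta> \<Longrightarrow>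
          (\<lambda>k. \<nu> s / \<omega> s powr (real k * \<alpha> + 1) * \<phi> k x)
            sums general_transform \<nu> \<omega> (\<psi> x) s"
  shows "(\<forall>k<n. \<forall>x\<in>I. \<phi> k x = f k x) \<and>
    (\<forall>x\<in>I. \<phi> n x = nonlinear_op I c M Q (f 0) x + h x 0) \<and>
    (\<forall>k>n. \<forall>x\<in>I.
       ((caputo \<alpha> ^^ (k - n))
          (\<lambda>t. nonlinear_op I c M Q
                  (\<lambda>y. \<Sum>m=0..k-n. \<phi> m y * t powr (real m * \<alpha>) / Gamma (1 + real m * \<alpha>)) x
                + h x t)
        \<longlongrightarrow> \<phi> k x) (at_right 0))"
proof -
  \<comment> \<open>\<open>V x q\<close>, \<open>N x\<close> and \<open>H x\<close> are the series of \<open>D\<^sub>x\<^sup>q \<psi>\<close>, of the nonlinear term and of \<open>h\<close>.\<close>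
  define V where "V x q = Abs_fps (\<lambda>k. (deriv_on I ^^ q) (\<phi> k) x / Gamma (real k * \<alpha> + 1))" for x q
  define N where "N x = nonlinear_fps (\<lambda>p. c p x) M Q (V x)" for x
  define H where "H x = (caputo_fps \<alpha> ^^ n) (V x 0) - N x" for x
  have Gamma_pos: "Gamma (real k * \<alpha> + 1) > 0" for k
    using alpha by (intro Gamma_real_pos add_nonneg_pos) auto
  have powr_mult: "t powr (real k * \<alpha>) = (t powr \<alpha>) ^ k" if "t > 0" for t k
    using that by (simp add: powr_power mult_ac)
  have V: "frac_expansion \<alpha> (\<lambda>t. (deriv_on I ^^ q) (\<lambda>y. \<psi> y t) x) (V x q)"
    if "x \<in> I" "q \<le> Q" for x q
    using termwise[OF that(1) _ that(2)] unfolding frac_expansion_def V_def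
    by (simp add: powr_mult)
  have psi: "frac_expansion \<alpha> (\<psi> x) (V x 0)" if "x \<in> I" for x
    using V[OF that, of 0] by simp
  have N: "frac_expansion \<alpha> (\<lambda>t. nonlinear_op I c M Q (\<lambda>y. \<psi> y t) x) (N x)" if "x \<in> I" for x
    unfolding N_def using that by (intro frac_expansion_nonlinear_op alpha V)
  have H: "frac_expansion \<alpha> (h x) (H x)" if x: "x \<in> I" for x
  proof (rule frac_expansion_cong)
    show "frac_expansion \<alpha> (\<lambda>t. (caputo \<alpha> ^^ n) (\<psi> x) t - nonlinear_op I c M Q (\<lambda>y. \<psi> y t) x) (H x)"
      unfolding H_def by (intro frac_expansion_diff frac_expansion_caputo_iter alpha psi N x)
  qed (simp add: equation x)
  have H_nth: "fps_nth (H x) k =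
      (\<phi> (k + n) x / Gamma (real k * \<alpha> + 1)) - fps_nth (N x) k" for x k
    using Gamma_pos[of "k + n"] alpha(1) by (simp add: H_def caputo_fps_iter_nth V_def)

  have initial_coeffs: "\<phi> k x = f k x" if "k < n" "x \<in> I" for k x
  proof -
    have "((caputo \<alpha> ^^ k) (\<psi> x) \<longlongrightarrow> \<phi> k x) (at_right 0)"
      using caputo_iter_tendsto[OF alpha psi[OF that(2)], of k] Gamma_pos[of k]
      by (simp add: V_def)
    from tendsto_unique[OF _ this initial[OF that(2,1)]] show ?thesis by simp
  qed

  have nth_coeff: "\<phi> n x = nonlinear_op I c M Q (f 0) x + h x 0" if x: "x \<in> I" for x
  proof -
    have "(h x \<longlongrightarrow> h x 0) (at_right 0)"
      using h_cont[OF x] by (simp add: continuous_within)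
    then have "h x 0 = fps_nth (H x) 0"
      using frac_expansion_tendsto[OF alpha(1) H[OF x]] tendsto_unique[OF _ _ ] by force
    moreover have "fps_nth (N x) 0 = nonlinear_op I c M Q (\<phi> 0) x"
      by (simp add: N_def nonlinear_fps_def nonlinear_op_def V_def fps_sum_nth fps_power_zeroth)
    moreover have "nonlinear_op I c M Q (\<phi> 0) x = nonlinear_op I c M Q (f 0) x"
      using n x by (intro nonlinear_op_cong initial_coeffs) auto
    ultimately show ?thesis by (simp add: H_nth)
  qed

  have later_coeffs: "((caputo \<alpha> ^^ K)
      (\<lambda>t. nonlinear_op I c M Q
              (\<lambda>y. \<Sum>m=0..K. \<phi> m y * t powr (real m * \<alpha>) / Gamma (1 + real m * \<alpha>)) x + h x t)
      \<longlongrightarrow> \<phi> (K + n) x) (at_right 0)" if x: "x \<in> I" for K x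
  proof -
    define N' where "N' = nonlinear_fps (\<lambda>p. c p x) M Q (\<lambda>q. fps_cutoff (Suc K) (V x q))"
    have "frac_expansion \<alpha> (\<lambda>t. (deriv_on I ^^ q)
        (\<lambda>y. \<Sum>m=0..K. \<phi> m y * t powr (real m * \<alpha>) / Gamma (1 + real m * \<alpha>)) x)
        (fps_cutoff (Suc K) (V x q))" if "q \<le> Q" for q
    proof (rule frac_expansion_cong[OF frac_expansion_partial_sum])
      fix t :: real assume "t > 0"
      define b where "b m = (t powr \<alpha>) ^ m / Gamma (real m * \<alpha> + 1)" for m
      have b: "\<phi> m y * t powr (real m * \<alpha>) / Gamma (1 + real m * \<alpha>) = b m * \<phi> m y" for m y
        using \<open>t > 0\<close> by (simp add: b_def powr_mult add.commute)
      have "(deriv_on I ^^ q)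
          (\<lambda>y. \<Sum>m=0..K. \<phi> m y * t powr (real m * \<alpha>) / Gamma (1 + real m * \<alpha>)) x =
          (deriv_on I ^^ q) (\<lambda>y. \<Sum>m=0..K. b m * \<phi> m y) x"
        by (simp only: b)
      also have "\<dots> = (\<Sum>m=0..K. b m * (deriv_on I ^^ q) (\<phi> m) x)"
        by (rule deriv_on_iter_sum[OF I finite_atLeastAtMost phi_diff that x])
      also have "\<dots> = (\<Sum>m=0..K. fps_nth (V x q) m * (t powr \<alpha>) ^ m)"
        by (simp add: b_def V_def mult.commute)
      finally show "(\<Sum>m=0..K. fps_nth (V x q) m * (t powr \<alpha>) ^ m) = (deriv_on I ^^ q)
          (\<lambda>y. \<Sum>m=0..K. \<phi> m y * t powr (real m * \<alpha>) / Gamma (1 + real m * \<alpha>)) x" ..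
    qed
    then have "frac_expansion \<alpha> (\<lambda>t. nonlinear_op I c M Q
        (\<lambda>y. \<Sum>m=0..K. \<phi> m y * t powr (real m * \<alpha>) / Gamma (1 + real m * \<alpha>)) x) N'"
      unfolding N'_def by (intro frac_expansion_nonlinear_op alpha)
    note limit = caputo_iter_tendsto[OF alpha frac_expansion_add[OF this H[OF x]], of K]
    have "fps_cutoff (Suc K) N' = fps_cutoff (Suc K) (N x)"
      unfolding N'_def N_def
      by (intro nonlinear_fps_cutoff_cong) (simp add: fps_cutoff_eq_fps_cutoff_iff)
    then have "fps_nth N' K = fps_nth (N x) K"
      by (simp add: fps_cutoff_eq_fps_cutoff_iff)
    then have "fps_nth (N' + H x) K * Gamma (real K * \<alpha> + 1) = \<phi> (K + n) x"
      using Gamma_pos[of K] by (simp add: H_nth)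
    with limit show ?thesis by (simp only:)
  qed
  show ?thesis
  proof (intro conjI allI impI ballI)
    fix k x assume "n < k" "x \<in> I"
    then show "((caputo \<alpha> ^^ (k - n))
          (\<lambda>t. nonlinear_op I c M Q
                  (\<lambda>y. \<Sum>m=0..k-n. \<phi> m y * t powr (real m * \<alpha>) / Gamma (1 + real m * \<alpha>)) x
                + h x t)
        \<longlongrightarrow> \<phi> k x) (at_right 0)"
      using later_coeffs[of x "k - n"] by (simp only: le_add_diff_inverse2 less_imp_le)
  qed (use initial_coeffs nth_coeff in blast)+
qed

end
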